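(* Let $\tau_1$, $\delta_\eta$ and $\tilde\tau$ be as defined in the context, and for $\kappa\in(0,2]$ define $$\tau_2(\kappa)=\inf_{u\in(0,\kappa]}\ \inf_{\eta>0}\ \tilde\tau(\eta,u).$$ Then $\kappa\mapsto\tau_2(\kappa)$ is a continuous and non-increasing function of $\kappa\in(0,2]$.
   Context: $\log$ is the natural logarithm, and $H(p)=-p\log p-(1-p)\log(1-p)$ is the binary entropy. For $\kappa\in(0,2]$, $\tau_1(\kappa)=\frac{1}{\log 2}\left[-\frac{\kappa^4}{128}+\frac{\kappa^2}{8}-\frac12\log\frac{\kappa}{2}-\frac38\right]$. For $\eta>0$, $\delta_\eta\in(0,1)$ is the unique solution $\delta$ of $H\left(\frac{1+\delta}{2}\right)=\frac{\eta}{1+\eta}\log 2$. For $\eta>0$ and $\kappa\in(0,2]$, writing $\delta=\delta_\eta$, $$\tilde\tau(\eta,\kappa)=\max\left\{(1+\eta)\tau_1(\kappa),\ \frac{1+\delta^2}{2(1-\delta^2)^2}+\frac{\delta(1+6\delta+3\delta^2+2\delta^3)}{(1-\delta^2)^3(1-\delta)}\,\kappa+\left[\frac{2(1+\delta)^5}{(1-\delta^2)^4}-\frac{1+3\delta^2}{4(1-\delta^2)^3}\right]\kappa^2+\frac{\kappa^4(1+3\delta^2)}{32(1-\delta^2)^3}\right\}.$$ *)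

theory Defs
  imports Complex_Main
begin

definition binary_entropy :: "real \<Rightarrow> real" where
  "binary_entropy p = - p * ln p - (1 - p) * ln (1 - p)"

definition tau1 :: "real \<Rightarrow> real" where
  "tau1 \<kappa> = (1 / ln 2) * (- (\<kappa> ^ 4 / 128) + \<kappa> ^ 2 / 8 - (1 / 2) * ln (\<kappa> / 2) - 3 / 8)"

(* Meaningful for \<eta> > 0 only: the right-hand side then lies strictly between 0 and ln 2, and
   \<delta> \<mapsto> binary_entropy ((1 + \<delta>) / 2) decreases strictly from ln 2 to 0 on the unit interval. *)
definition delta_of :: "real \<Rightarrow> real" where
  "delta_of \<eta> = (THE \<delta>. 0 < \<delta> \<and> \<delta> < 1 \<and>
      binary_entropy ((1 + \<delta>) / 2) = \<eta> / (1 + \<eta>) * ln 2)"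

definition tau_tilde :: "real \<Rightarrow> real \<Rightarrow> real" where
  "tau_tilde \<eta> \<kappa> = (let \<delta> = delta_of \<eta> in
     max ((1 + \<eta>) * tau1 \<kappa>)
         ((1 + \<delta>^2) / (2 * (1 - \<delta>^2)^2)
          + \<delta> * (1 + 6 * \<delta> + 3 * \<delta>^2 + 2 * \<delta>^3) / ((1 - \<delta>^2)^3 * (1 - \<delta>)) * \<kappa>
          + (2 * (1 + \<delta>)^5 / (1 - \<delta>^2)^4 - (1 + 3 * \<delta>^2) / (4 * (1 - \<delta>^2)^3)) * \<kappa>^2
          + \<kappa>^4 * (1 + 3 * \<delta>^2) / (32 * (1 - \<delta>^2)^3)))"

(* Real-valued infima: both index sets are nonempty for \<kappa> in (0, 2], and there tau_tilde is
   bounded below by 0, since tau1 is non-increasing on (0, 2] with tau1 2 = 0. *)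
definition tau2 :: "real \<Rightarrow> real" where
  "tau2 \<kappa> = (INF u\<in>{0<..\<kappa>}. INF \<eta>\<in>{0<..}. tau_tilde \<eta> u)"

end

theory Submission imports Defs "HOL-Real_Asymp.Real_Asymp" begin

text \<open>
  Monotonicity of \<open>tau2\<close> only needs that the inner infimum
  \<open>g u = (INF \<eta>\<in>{0<..}. tau_tilde \<eta> u)\<close> is bounded below. For continuity, a running
  infimum of a continuous function is continuous, so the point is that \<open>g\<close> is continuous.

  An infimum of continuous functions is always upper semicontinuous. Lower semicontinuity
  needs some uniformity in \<open>\<eta>\<close>, but for \<open>0 < u < 2\<close> the value \<open>tau_tilde \<eta> u\<close> blows up
  both as \<open>\<eta> \<rightarrow> 0\<close> (because then \<open>delta_of \<eta> \<rightarrow> 1\<close>) and as \<open>\<eta> \<rightarrow> \<infinity>\<close>. The right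
  uniformity is therefore multiplicative: for every \<open>a < 1\<close> and every \<open>x\<close> close enough to
  \<open>x0\<close>, the bound \<open>a * tau_tilde \<eta> x0 \<le> tau_tilde \<eta> x\<close> holds for all \<open>\<eta>\<close> at
  once. The two branches of the maximum satisfy it separately. In the first branch \<open>\<eta>\<close> enters
  as a factor, so it is enough that \<open>tau1\<close> is continuous and nonnegative. The second branch is a
  quartic in \<open>u\<close> whose coefficients depend on \<open>\<eta>\<close> but are all nonnegative; shrinking the
  argument of such a quartic by a factor \<open>t \<le> 1\<close> costs at most the factor \<open>t ^ 4\<close>,
  whatever the coefficients are. Nonnegativity of the coefficients uses \<open>0 < delta_of \<eta> < 1\<close>,
  which comes from the entropy equation having a unique solution.
\<close>

section \<open>Infima of families and running infima\<close>

text \<open>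
  Upper semicontinuity comes from one nearly minimal member of the family, lower
  semicontinuity from the multiplicative bound, which passes to the infimum.
\<close>

lemma tendsto_INF_of_uniform_ratio:
  fixes f :: "'i \<Rightarrow> 'a::topological_space \<Rightarrow> real"
  assumes "I \<noteq> {}" "x0 \<in> S"
    and nonneg: "\<And>i x. i \<in> I \<Longrightarrow> x \<in> S \<Longrightarrow> 0 \<le> f i x"
    and lim: "\<And>i. i \<in> I \<Longrightarrow> (f i \<longlongrightarrow> f i x0) (at x0 within S)"
    and ratio: "\<And>a. 0 < a \<Longrightarrow> a < 1 \<Longrightarrow>
      eventually (\<lambda>x. \<forall>i\<in>I. a * f i x0 \<le> f i x) (at x0 within S)"
  shows "((\<lambda>x. INF i\<in>I. f i x) \<longlongrightarrow> (INF i\<in>I. f i x0)) (at x0 within S)"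
proof (rule order_tendstoI)
  have bdd: "bdd_below ((\<lambda>i. f i x) ` I)" if "x \<in> S" for x
    using nonneg that by (intro bdd_belowI[of _ 0]) auto
  have inS: "eventually (\<lambda>x. x \<in> S) (at x0 within S)"
    by (simp add: eventually_at_filter)
  have nn: "0 \<le> (INF i\<in>I. f i x0)"
    using assms by (intro cINF_greatest) auto
  {
    fix b assume b: "b < (INF i\<in>I. f i x0)"
    have "((\<lambda>a::real. a * (INF i\<in>I. f i x0)) \<longlongrightarrow> 1 * (INF i\<in>I. f i x0)) (at_left 1)"
      by (intro tendsto_intros)
    then have "eventually (\<lambda>a. b < a * (INF i\<in>I. f i x0)) (at_left 1)"
      using b by (auto dest: order_tendstoD)
    moreover have "eventually (\<lambda>a::real. 0 < a \<and> a < 1) (at_left 1)"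
      using eventually_at_left_real[of 0 1] by (auto elim: eventually_mono)
    ultimately have "eventually (\<lambda>a. b < a * (INF i\<in>I. f i x0) \<and> 0 < a \<and> a < 1) (at_left 1)"
      by eventually_elim auto
    then obtain a where a: "b < a * (INF i\<in>I. f i x0)" "0 < a" "a < 1"
      using eventually_happens trivial_limit_at_left_real by blast
    show "eventually (\<lambda>x. b < (INF i\<in>I. f i x)) (at x0 within S)"
      using ratio[OF a(2,3)]
    proof eventually_elim
      case (elim x)
      have "a * (INF i\<in>I. f i x0) \<le> f i x" if "i \<in> I" for i
      proof -
        have "a * (INF i\<in>I. f i x0) \<le> a * f i x0"
          using a that \<open>x0 \<in> S\<close> by (intro mult_left_mono cINF_lower bdd) auto
        then show ?thesis using elim that by force
      qed
      then have "a * (INF i\<in>I. f i x0) \<le> (INF i\<in>I. f i x)"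
        using \<open>I \<noteq> {}\<close> by (intro cINF_greatest) auto
      then show ?case using a by simp
    qed
  next
    fix b assume "(INF i\<in>I. f i x0) < b"
    then obtain i where i: "i \<in> I" "f i x0 < b"
      using \<open>I \<noteq> {}\<close> bdd[OF \<open>x0 \<in> S\<close>] by (auto simp: cINF_less_iff)
    show "eventually (\<lambda>x. (INF i\<in>I. f i x) < b) (at x0 within S)"
      using order_tendstoD(2)[OF lim[OF i(1)] i(2)] inS
    proof eventually_elim
      case (elim x)
      then show ?case using cINF_lower[OF bdd i(1), of x] by simp
    qed
  }
qed

lemma antimono_on_running_INF:
  fixes g :: "real \<Rightarrow> real"
  assumes bdd: "\<And>u. l < u \<Longrightarrow> u \<le> r \<Longrightarrow> m \<le> g u"
  shows "antimono_on {l<..r} (\<lambda>x. INF u\<in>{l<..x}. g u)"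
proof (rule monotone_onI)
  fix x y assume "x \<in> {l<..r}" "y \<in> {l<..r}" "x \<le> y"
  then show "(INF u\<in>{l<..x}. g u) \<ge> (INF u\<in>{l<..y}. g u)"
    using bdd by (intro cINF_superset_mono bdd_belowI[of _ m]) auto
qed

text \<open>
  For \<open>x \<le> y\<close>, the infimum up to \<open>y\<close> takes in new values \<open>g u\<close> with \<open>x < u \<le> y\<close>. The
  value \<open>g x\<close> already counted at \<open>x\<close>, so the infimum drops by at most the oscillation of
  \<open>g\<close> between \<open>x\<close> and \<open>y\<close>, which continuity of \<open>g\<close> makes small.
\<close>

lemma continuous_on_running_INF:
  fixes g :: "real \<Rightarrow> real"
  assumes cont: "continuous_on {l<..r} g"
    and bdd: "\<And>u. l < u \<Longrightarrow> u \<le> r \<Longrightarrow> m \<le> g u"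
  shows "continuous_on {l<..r} (\<lambda>x. INF u\<in>{l<..x}. g u)"
proof -
  let ?G = "\<lambda>x. INF u\<in>{l<..x}. g u"
  have lower: "?G y \<le> g u" if "l < u" "u \<le> y" "y \<le> r" for u y
    using that bdd by (intro cINF_lower bdd_belowI[of _ m]) auto
  have anti: "?G y \<le> ?G x" if "l < x" "x \<le> y" "y \<le> r" for x y
    using monotone_onD[OF antimono_on_running_INF[OF bdd]] that by auto
  have step: "?G x \<le> ?G y + e"
    if xy: "l < x" "x \<le> y" "y \<le> r" and osc: "\<And>u. x \<le> u \<Longrightarrow> u \<le> y \<Longrightarrow> g x \<le> g u + e" "0 \<le> e"
    for x y e
  proof -
    have "?G x - e \<le> g u" if u: "u \<in> {l<..y}" for u
    proof (cases "u \<le> x")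
      case True
      then show ?thesis using lower[of u x] u xy osc(2) by auto
    next
      case False
      then show ?thesis using lower[of x x] osc(1)[of u] u xy by auto
    qed
    then have "?G x - e \<le> ?G y"
      using xy by (intro cINF_greatest) auto
    then show ?thesis by simp
  qed
  show ?thesis
    unfolding continuous_on_def
  proof (intro ballI tendstoI)
    fix x0 e :: real assume x0: "x0 \<in> {l<..r}" and e: "0 < e"
    have "eventually (\<lambda>x. dist (g x) (g x0) < e / 3) (at x0 within {l<..r})"
      using cont x0 e by (intro tendstoD) (auto simp: continuous_on_def)
    then obtain d where d: "0 < d"
      "\<And>x. x \<in> {l<..r} \<Longrightarrow> x \<noteq> x0 \<Longrightarrow> dist x x0 < d \<Longrightarrow> dist (g x) (g x0) < e / 3"
      unfolding eventually_at by blast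
    have near: "dist (g x) (g x0) < e / 3" if "x \<in> {l<..r}" "dist x x0 < d" for x
      using d(2)[of x] that e by (cases "x = x0") auto
    have close: "dist (?G x) (?G x0) < e" if x: "x \<in> {l<..r}" "dist x x0 < d" for x
    proof (cases "x \<le> x0")
      case True
      have "g x \<le> g u + 2 * e / 3" if "x \<le> u" "u \<le> x0" for u
      proof -
        have "\<bar>g u - g x0\<bar> < e / 3" "\<bar>g x - g x0\<bar> < e / 3"
          using near[of u] near[of x] that x x0 True by (auto simp: dist_real_def)
        then show ?thesis by linarith
      qed
      then have "?G x \<le> ?G x0 + 2 * e / 3"
        using True x x0 e by (intro step) auto
      then show ?thesis using anti[of x x0] True x x0 e by (auto simp: dist_real_def)
    next
      case False
      have "g x0 \<le> g u + 2 * e / 3" if "x0 \<le> u" "u \<le> x" for u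
      proof -
        have "\<bar>g u - g x0\<bar> < e / 3"
          using near[of u] that x x0 False by (auto simp: dist_real_def)
        then show ?thesis using e by linarith
      qed
      then have "?G x0 \<le> ?G x + 2 * e / 3"
        using False x x0 e by (intro step) auto
      then show ?thesis using anti[of x0 x] False x x0 e by (auto simp: dist_real_def)
    qed
    show "eventually (\<lambda>x. dist (?G x) (?G x0) < e) (at x0 within {l<..r})"
      unfolding eventually_at using d(1) close by blast
  qed
qed

section \<open>The entropy equation\<close>

lemma continuous_on_mult_ln: "continuous_on {0..} (\<lambda>x::real. x * ln x)"
proof -
  have "((\<lambda>x::real. x * ln x) \<longlongrightarrow> 0) (at_right 0)"
    by real_asymp
  then have "continuous (at x within {0..}) (\<lambda>x::real. x * ln x)" if "0 \<le> x" for x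
  proof (cases "x = 0")
    case True
    have "at (0::real) within {0..} = at_right 0"
      by (auto simp: at_within_def intro!: arg_cong2[where f = inf] arg_cong[where f = principal])
    then show ?thesis
      using True \<open>((\<lambda>x::real. x * ln x) \<longlongrightarrow> 0) (at_right 0)\<close> by (simp add: continuous_within)
  next
    case False
    then show ?thesis
      unfolding continuous_within by (intro tendsto_intros) auto
  qed
  then show ?thesis by (auto simp: continuous_on_eq_continuous_within)
qed

lemma continuous_on_binary_entropy: "continuous_on {0..1} binary_entropy"
proof -
  have "continuous_on {0..1} (\<lambda>p::real. p * ln p)"
    by (rule continuous_on_subset[OF continuous_on_mult_ln]) auto
  moreover have "continuous_on {0..1} (\<lambda>p::real. (1 - p) * ln (1 - p))"
    by (rule continuous_on_compose2[OF continuous_on_mult_ln, of _ "\<lambda>p. 1 - p"])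
       (auto intro!: continuous_intros)
  ultimately have "continuous_on {0..1} (\<lambda>p::real. - (p * ln p) - (1 - p) * ln (1 - p))"
    by (intro continuous_on_diff continuous_on_minus)
  then show ?thesis
    by (simp add: binary_entropy_def[abs_def])
qed

lemma binary_entropy_strict_antimono:
  assumes "1 / 2 < p" "p < q" "q < 1"
  shows "binary_entropy q < binary_entropy p"
proof (rule DERIV_neg_imp_decreasing[OF \<open>p < q\<close>])
  fix x assume x: "p \<le> x" "x \<le> q"
  have "(binary_entropy has_real_derivative ln (1 - x) - ln x) (at x)"
    unfolding binary_entropy_def[abs_def]
    using x assms by (auto intro!: derivative_eq_intros)
  moreover have "ln (1 - x) < ln x" using x assms by auto
  ultimately show "\<exists>y. (binary_entropy has_real_derivative y) (at x) \<and> y < 0"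
    by (intro exI[of _ "ln (1 - x) - ln x"]) auto
qed

text \<open>
  The intermediate value theorem gives a solution on the closed unit interval, where the entropy
  takes the values \<open>ln 2\<close> and \<open>0\<close> at the ends because \<open>x * ln x\<close> extends continuously to
  \<open>0\<close>. Strict monotonicity makes the solution unique, so the description operator selects it.
\<close>

lemma delta_of_bounds:
  assumes "0 < \<eta>"
  shows "0 < delta_of \<eta> \<and> delta_of \<eta> < 1"
proof -
  let ?h = "\<lambda>\<delta>. binary_entropy ((1 + \<delta>) / 2)"
  let ?c = "\<eta> / (1 + \<eta>) * ln 2"
  have c: "0 < ?c" "?c < ln 2" using assms by (auto simp: field_simps)
  have h0: "?h 0 = ln 2"
    by (simp add: binary_entropy_def ln_div)
  have h1: "?h 1 = 0" by (simp add: binary_entropy_def)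
  have "continuous_on {0..1} ?h"
    by (rule continuous_on_compose2[OF continuous_on_binary_entropy])
       (auto intro!: continuous_intros)
  then obtain \<delta> where \<delta>: "0 \<le> \<delta>" "\<delta> \<le> 1" "?h \<delta> = ?c"
    using IVT2'[of ?h 1 ?c 0] c h0 h1 by auto
  then have "\<delta> \<noteq> 0" "\<delta> \<noteq> 1" using c h0 h1 by auto
  then have sol: "0 < \<delta> \<and> \<delta> < 1 \<and> ?h \<delta> = ?c" using \<delta> by auto
  moreover have "\<delta>' = \<delta>" if "0 < \<delta>' \<and> \<delta>' < 1 \<and> ?h \<delta>' = ?c" for \<delta>'
    using that sol binary_entropy_strict_antimono[of "(1 + \<delta>) / 2" "(1 + \<delta>') / 2"]
      binary_entropy_strict_antimono[of "(1 + \<delta>') / 2" "(1 + \<delta>) / 2"]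
    by (cases \<delta> \<delta>' rule: linorder_cases) auto
  ultimately have "delta_of \<eta> = \<delta>"
    unfolding delta_of_def by (rule the_equality)
  then show ?thesis using sol by simp
qed

section \<open>The two branches of the maximum\<close>

lemma continuous_on_tau1: "continuous_on {0<..} tau1"
  unfolding tau1_def[abs_def] by (intro continuous_intros) auto

text \<open>
  Up to the factor \<open>1 / ln 2\<close>, the derivative of \<open>tau1\<close> is
  \<open>- (\<kappa>\<^sup>2 - 4)\<^sup>2 / (32 * \<kappa>)\<close>, so \<open>tau1\<close> decreases to \<open>tau1 2 = 0\<close>.
\<close>

lemma tau1_nonneg:
  assumes "0 < \<kappa>" "\<kappa> \<le> 2"
  shows "0 \<le> tau1 \<kappa>"
proof -
  have "tau1 2 \<le> tau1 \<kappa>"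
  proof (rule DERIV_nonpos_imp_nonincreasing[OF \<open>\<kappa> \<le> 2\<close>])
    fix x assume x: "\<kappa> \<le> x" "x \<le> 2"
    have "(tau1 has_real_derivative (1 / ln 2) * (- ((x\<^sup>2 - 4)\<^sup>2 / (32 * x)))) (at x)"
      unfolding tau1_def[abs_def]
      using x assms
      by (auto intro!: derivative_eq_intros simp: field_simps power2_eq_square power3_eq_cube)
    moreover have "(1 / ln 2) * (- ((x\<^sup>2 - 4)\<^sup>2 / (32 * x))) \<le> 0"
      using x assms by (intro mult_nonneg_nonpos) auto
    ultimately show "\<exists>y. (tau1 has_real_derivative y) (at x) \<and> y \<le> 0"
      by blast
  qed
  moreover have "tau1 2 = 0" by (simp add: tau1_def)
  ultimately show ?thesis by simp
qed

definition quartic_branch :: "real \<Rightarrow> real \<Rightarrow> real" where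
  "quartic_branch \<delta> \<kappa> =
     (1 + \<delta>^2) / (2 * (1 - \<delta>^2)^2)
     + \<delta> * (1 + 6 * \<delta> + 3 * \<delta>^2 + 2 * \<delta>^3) / ((1 - \<delta>^2)^3 * (1 - \<delta>)) * \<kappa>
     + (2 * (1 + \<delta>)^5 / (1 - \<delta>^2)^4 - (1 + 3 * \<delta>^2) / (4 * (1 - \<delta>^2)^3)) * \<kappa>^2
     + \<kappa>^4 * (1 + 3 * \<delta>^2) / (32 * (1 - \<delta>^2)^3)"

lemma tau_tilde_eq_max:
  "tau_tilde \<eta> \<kappa> = max ((1 + \<eta>) * tau1 \<kappa>) (quartic_branch (delta_of \<eta>) \<kappa>)"
  by (simp only: tau_tilde_def quartic_branch_def Let_def)

text \<open>
  Only the quadratic coefficient has a negative part. Over the common denominator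
  \<open>4 * (1 - \<delta>\<^sup>2) ^ 4\<close> its numerator is \<open>8 * (1 + \<delta>) ^ 5 - (1 + 3 * \<delta>\<^sup>2) * (1 - \<delta>\<^sup>2)\<close>,
  where the first term is at least \<open>8\<close> and the second at most \<open>4\<close>.
\<close>

lemma quartic_branch_nonneg_coeffs:
  assumes "0 < \<delta>" "\<delta> < 1"
  obtains A B C D where "0 \<le> A" "0 \<le> B" "0 \<le> C" "0 \<le> D"
    "\<And>\<kappa>. quartic_branch \<delta> \<kappa> = A + B * \<kappa> + C * \<kappa>^2 + D * \<kappa>^4"
proof -
  have s: "0 < 1 - \<delta>^2" "\<delta>^2 \<le> 1"
    using assms power_strict_mono[of \<delta> 1 2] by auto
  have "(1 + 3 * \<delta>^2) * (1 - \<delta>^2) \<le> 4 * 1"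
    using s by (intro mult_mono) auto
  moreover have "1 \<le> (1 + \<delta>)^5" using assms by (intro one_le_power) auto
  ultimately have "(1 + 3 * \<delta>^2) * (1 - \<delta>^2) \<le> 8 * (1 + \<delta>)^5" by linarith
  then have "(1 + 3 * \<delta>^2) * (1 - \<delta>^2) / (4 * (1 - \<delta>^2)^4) \<le> 8 * (1 + \<delta>)^5 / (4 * (1 - \<delta>^2)^4)"
    using s by (intro divide_right_mono) auto
  moreover have "(1 + 3 * \<delta>^2) * (1 - \<delta>^2) / (4 * (1 - \<delta>^2)^4) = (1 + 3 * \<delta>^2) / (4 * (1 - \<delta>^2)^3)"
    using s by (simp add: divide_simps eval_nat_numeral)
  ultimately have C: "0 \<le> 2 * (1 + \<delta>)^5 / (1 - \<delta>^2)^4 - (1 + 3 * \<delta>^2) / (4 * (1 - \<delta>^2)^3)"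
    by simp
  show thesis
    by (rule that[OF _ _ C, of "(1 + \<delta>^2) / (2 * (1 - \<delta>^2)^2)"
          "\<delta> * (1 + 6 * \<delta> + 3 * \<delta>^2 + 2 * \<delta>^3) / ((1 - \<delta>^2)^3 * (1 - \<delta>))"
          "(1 + 3 * \<delta>^2) / (32 * (1 - \<delta>^2)^3)"])
       (use s assms in \<open>auto simp: quartic_branch_def\<close>)
qed

lemma quartic_branch_scaling:
  assumes "0 < \<delta>" "\<delta> < 1" and t: "0 \<le> t" "t \<le> 1" and "0 \<le> x0" "t * x0 \<le> x"
  shows "t^4 * quartic_branch \<delta> x0 \<le> quartic_branch \<delta> x"
proof -
  obtain A B C D where co: "0 \<le> A" "0 \<le> B" "0 \<le> C" "0 \<le> D"
    and eq: "\<And>\<kappa>. quartic_branch \<delta> \<kappa> = A + B * \<kappa> + C * \<kappa>^2 + D * \<kappa>^4"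
    using quartic_branch_nonneg_coeffs[OF assms(1,2)] by metis
  have tx: "0 \<le> t * x0" using assms by auto
  have pow: "t^4 * x0^k \<le> x^k" if "k \<le> 4" for k
  proof -
    have "t^4 * x0^k \<le> t^k * x0^k"
      using that assms by (intro mult_right_mono power_decreasing) auto
    also have "\<dots> = (t * x0)^k" by (simp add: power_mult_distrib)
    also have "\<dots> \<le> x^k" using tx assms by (intro power_mono) auto
    finally show ?thesis .
  qed
  have "A * (t^4 * x0^0) + B * (t^4 * x0^1) + C * (t^4 * x0^2) + D * (t^4 * x0^4)
      \<le> A * x^0 + B * x^1 + C * x^2 + D * x^4"
    by (intro add_mono mult_left_mono pow co) auto
  then show ?thesis by (simp add: eq algebra_simps)
qed

section \<open>The inner infimum\<close>

lemma tau_tilde_nonneg: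
  assumes "0 < \<eta>" "0 < \<kappa>" "\<kappa> \<le> 2"
  shows "0 \<le> tau_tilde \<eta> \<kappa>"
  using tau1_nonneg[of \<kappa>] assms by (simp add: tau_tilde_eq_max le_max_iff_disj)

lemma continuous_on_tau_tilde: "continuous_on {0<..} (tau_tilde \<eta>)"
proof -
  have quartic: "continuous_on {0<..} (\<lambda>\<kappa>. A + B * \<kappa> + C * \<kappa>^2 + \<kappa>^4 * D * E)" for A B C D E :: real
    by (intro continuous_intros)
  have "continuous_on {0<..} (quartic_branch (delta_of \<eta>))"
    unfolding quartic_branch_def[abs_def] divide_inverse by (rule quartic)
  then show ?thesis
    unfolding tau_tilde_eq_max[abs_def] by (intro continuous_intros continuous_on_tau1)
qed

text \<open>
  The factor that works for the quartic branch is \<open>t ^ 4\<close> with \<open>t = min 1 (x / x0)\<close>, which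
  tends to \<open>1\<close>. For the other branch, continuity of \<open>tau1\<close> gives
  \<open>a * tau1 x0 \<le> tau1 x\<close> when \<open>tau1 x0 > 0\<close>; at the zero \<open>x0 = 2\<close> nonnegativity of
  \<open>tau1\<close> takes over.
\<close>

lemma tau_tilde_uniform_ratio:
  assumes x0: "0 < x0" "x0 \<le> 2" and a: "0 < a" "a < 1"
  shows "eventually (\<lambda>x. \<forall>\<eta>\<in>{0<..}. a * tau_tilde \<eta> x0 \<le> tau_tilde \<eta> x) (at x0 within {0<..2})"
proof -
  have inS: "eventually (\<lambda>x. 0 < x \<and> x \<le> 2) (at x0 within {0<..2})"
    by (simp add: eventually_at_filter)
  have "((\<lambda>x. (min 1 (x / x0))^4) \<longlongrightarrow> (min 1 (x0 / x0))^4) (at x0 within {0<..2})"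
    using x0 by (intro tendsto_intros) auto
  then have ev_t: "eventually (\<lambda>x. a < (min 1 (x / x0))^4) (at x0 within {0<..2})"
    by (rule order_tendstoD) (use a x0 in auto)
  have ev_tau1: "eventually (\<lambda>x. a * tau1 x0 \<le> tau1 x) (at x0 within {0<..2})"
  proof (cases "tau1 x0 = 0")
    case True
    show ?thesis using inS by eventually_elim (simp add: True tau1_nonneg)
  next
    case False
    then have "a * tau1 x0 < tau1 x0" using tau1_nonneg[OF x0] a by simp
    moreover have "(tau1 \<longlongrightarrow> tau1 x0) (at x0 within {0<..2})"
      using continuous_on_subset[OF continuous_on_tau1, of "{0<..2}"] x0
      by (simp add: continuous_on_def subset_iff)
    ultimately have "eventually (\<lambda>x. a * tau1 x0 < tau1 x) (at x0 within {0<..2})"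
      by (auto dest: order_tendstoD)
    then show ?thesis by eventually_elim simp
  qed
  show ?thesis using inS ev_t ev_tau1
  proof eventually_elim
    case (elim x)
    let ?t = "min 1 (x / x0)"
    show ?case
    proof
      fix \<eta> :: real assume "\<eta> \<in> {0<..}"
      then have \<eta>: "0 < \<eta>" by simp
      let ?Q = "quartic_branch (delta_of \<eta>)"
      have \<delta>: "0 < delta_of \<eta>" "delta_of \<eta> < 1" using delta_of_bounds[OF \<eta>] by auto
      \<comment> \<open>Scaling by the factor 0 is the statement that the quartic is nonnegative.\<close>
      have "0 \<le> ?Q x0"
        using quartic_branch_scaling[OF \<delta>, of 0 x0 x0] x0 by simp
      then have "a * ?Q x0 \<le> ?t^4 * ?Q x0"
        using elim by (intro mult_right_mono) auto
      also have "\<dots> \<le> ?Q x"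
        using elim x0 by (intro quartic_branch_scaling[OF \<delta>]) (auto simp: min_def field_simps)
      finally have "a * ?Q x0 \<le> ?Q x" .
      moreover have "(1 + \<eta>) * (a * tau1 x0) \<le> (1 + \<eta>) * tau1 x"
        using elim \<eta> by (intro mult_left_mono) auto
      ultimately have "max (a * ((1 + \<eta>) * tau1 x0)) (a * ?Q x0) \<le> max ((1 + \<eta>) * tau1 x) (?Q x)"
        by (intro max.mono) (simp_all add: mult.left_commute)
      then show "a * tau_tilde \<eta> x0 \<le> tau_tilde \<eta> x"
        using a by (simp add: tau_tilde_eq_max max_mult_distrib_left)
    qed
  qed
qed

lemma continuous_on_INF_tau_tilde:
  "continuous_on {0<..2} (\<lambda>x. INF \<eta>\<in>{0<..}. tau_tilde \<eta> x)"
  unfolding continuous_on_def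
proof
  fix x0 :: real assume x0: "x0 \<in> {0<..2}"
  show "((\<lambda>x. INF \<eta>\<in>{0<..}. tau_tilde \<eta> x) \<longlongrightarrow> (INF \<eta>\<in>{0<..}. tau_tilde \<eta> x0))
      (at x0 within {0<..2})"
  proof (rule tendsto_INF_of_uniform_ratio)
    show "(tau_tilde \<eta> \<longlongrightarrow> tau_tilde \<eta> x0) (at x0 within {0<..2})" for \<eta>
      using continuous_on_subset[OF continuous_on_tau_tilde, of "{0<..2}" \<eta>] x0
      by (simp add: continuous_on_def subset_iff)
  qed (use x0 in \<open>auto intro: tau_tilde_nonneg tau_tilde_uniform_ratio\<close>)
qed

lemma INF_tau_tilde_nonneg:
  assumes "0 < u" "u \<le> 2"
  shows "0 \<le> (INF \<eta>\<in>{0<..}. tau_tilde \<eta> u)"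
  using assms by (intro cINF_greatest) (auto intro: tau_tilde_nonneg)

theorem proposition1p7:
  shows "continuous_on {0<..2} tau2 \<and> antimono_on {0<..2} tau2"
  unfolding tau2_def[abs_def]
proof
  show "continuous_on {0<..2} (\<lambda>\<kappa>. INF u\<in>{0<..\<kappa>}. INF \<eta>\<in>{0<..}. tau_tilde \<eta> u)"
    by (rule continuous_on_running_INF[where m = 0])
       (fact continuous_on_INF_tau_tilde INF_tau_tilde_nonneg)+
  show "antimono_on {0<..2} (\<lambda>\<kappa>. INF u\<in>{0<..\<kappa>}. INF \<eta>\<in>{0<..}. tau_tilde \<eta> u)"
    by (rule antimono_on_running_INF[where m = 0]) (fact INF_tau_tilde_nonneg)
qed

end
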